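(* Let $G$ be a group, $A$ a $G$-module, and $C^n(G,A)=\{\sigma:G^n\to A\}$. For every $n$ and $1\le i\le n$, let the transposition $(i,i+1)$ act on $\sigma\in C^n(G,A)$ by $$((1,2)\sigma)(g_1,\dots,g_n)=-g_1\,\sigma(g_1^{-1},g_1g_2,g_3,\dots,g_n),$$ $$((i,i+1)\sigma)(g_1,\dots,g_n)=-\sigma(g_1,\dots,g_{i-2},g_{i-1}g_i,g_i^{-1},g_ig_{i+1},g_{i+2},\dots,g_n)\quad(2\le i\le n-1),$$ $$((n,n+1)\sigma)(g_1,\dots,g_n)=-\sigma(g_1,\dots,g_{n-2},g_{n-1}g_n,g_n^{-1})\quad (n\ge 2),$$ where for $n=1$ the action is $((1,2)\sigma)(g)=-g\sigma(g^{-1})$. These formulas define an action of the symmetric group $\Sigma_{n+1}$ on $C^n(G,A)$ which is compatible with the differential $\partial$: if $\sigma\in C^n(G,A)$ is invariant under $\Sigma_{n+1}$, then $\partial_n(\sigma)\in C^{n+1}(G,A)$ is invariant under $\Sigma_{n+2}$.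
   Context: The differential is the usual one, $\partial_n:C^n(G,A)\to C^{n+1}(G,A)$, $$\partial_n(\sigma)(g_1,\dots,g_{n+1})=g_1\sigma(g_2,\dots,g_{n+1})+\sum_{j=1}^{n}(-1)^j\sigma(g_1,\dots,g_jg_{j+1},\dots,g_{n+1})+(-1)^{n+1}\sigma(g_1,\dots,g_n).$$ $\Sigma_{n+1}$ is the symmetric group on $\{1,\dots,n+1\}$, generated by the transpositions $(i,i+1)$, $1\le i\le n$. *)

theory Defs
  imports "HOL-Algebra.Ring" "HOL-Algebra.Group_Action" "HOL-Algebra.Sym_Groups"
begin

text \<open>
  Abelian groups are written additively, as in the locale \<^locale>\<open>abelian_group\<close>; the
  multiplicative fields of the underlying record play no role.
\<close>

locale gmodule =
  group G + A: abelian_group A + group_action G "carrier A" act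
  for G :: "('g, 'm) monoid_scheme" and A :: "('a, 'r) ring_scheme" and act :: "'g \<Rightarrow> 'a \<Rightarrow> 'a" +
  assumes act_add: "\<lbrakk>g \<in> carrier G; x \<in> carrier A; y \<in> carrier A\<rbrakk>
    \<Longrightarrow> act g (x \<oplus>\<^bsub>A\<^esub> y) = act g x \<oplus>\<^bsub>A\<^esub> act g y"

text \<open>
  An element $(g_1,\dots,g_n)$ of $G^n$ is a function on \<^term>\<open>{1..n}\<close>, extended by
  \<^const>\<open>undefined\<close>; similarly, a cochain is extended by \<^const>\<open>undefined\<close> outside $G^n$.
  Thus two cochains are equal as terms iff they agree on $G^n$.
\<close>

definition tuples :: "('g, 'm) monoid_scheme \<Rightarrow> nat \<Rightarrow> (nat \<Rightarrow> 'g) set" where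
  "tuples G n = {1..n} \<rightarrow>\<^sub>E carrier G"

definition cochains ::
  "('g, 'm) monoid_scheme \<Rightarrow> ('a, 'r) ring_scheme \<Rightarrow> nat \<Rightarrow> ((nat \<Rightarrow> 'g) \<Rightarrow> 'a) set" where
  "cochains G A n = tuples G n \<rightarrow>\<^sub>E carrier A"

definition coboundary ::
  "('g, 'm) monoid_scheme \<Rightarrow> ('a, 'r) ring_scheme \<Rightarrow> ('g \<Rightarrow> 'a \<Rightarrow> 'a) \<Rightarrow> nat
    \<Rightarrow> ((nat \<Rightarrow> 'g) \<Rightarrow> 'a) \<Rightarrow> (nat \<Rightarrow> 'g) \<Rightarrow> 'a" where
  "coboundary G A act n \<sigma> = (\<lambda>g \<in> tuples G (n + 1).
     act (g 1) (\<sigma> (\<lambda>k \<in> {1..n}. g (k + 1)))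
     \<oplus>\<^bsub>A\<^esub> (\<Oplus>\<^bsub>A\<^esub>j \<in> {1..n}. [((-1) ^ j :: int)] \<cdot>\<^bsub>A\<^esub>
          \<sigma> (\<lambda>k \<in> {1..n}. if k < j then g k else if k = j then g j \<otimes>\<^bsub>G\<^esub> g (j + 1) else g (k + 1)))
     \<oplus>\<^bsub>A\<^esub> [((-1) ^ (n + 1) :: int)] \<cdot>\<^bsub>A\<^esub> \<sigma> (\<lambda>k \<in> {1..n}. g k))"

text \<open>
  The argument of $\sigma$ in $(i,i+1)\sigma$: the tuple
  $(g_1,\dots,g_{i-2},g_{i-1}g_i,g_i^{-1},g_ig_{i+1},g_{i+2},\dots,g_n)$. As the index ranges
  over \<^term>\<open>{1..n}\<close> only, the entry $g_{i-1}g_i$ is absent for $i=1$, and $g_ig_{i+1}$ is absent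
  for $i=n$.
\<close>

definition transposed_tuple ::
  "('g, 'm) monoid_scheme \<Rightarrow> nat \<Rightarrow> nat \<Rightarrow> (nat \<Rightarrow> 'g) \<Rightarrow> nat \<Rightarrow> 'g" where
  "transposed_tuple G n i g = (\<lambda>k \<in> {1..n}.
     if k + 1 = i then g k \<otimes>\<^bsub>G\<^esub> g i
     else if k = i then inv\<^bsub>G\<^esub> g i
     else if k = i + 1 then g i \<otimes>\<^bsub>G\<^esub> g k
     else g k)"

definition transposed_cochain ::
  "('g, 'm) monoid_scheme \<Rightarrow> ('a, 'r) ring_scheme \<Rightarrow> ('g \<Rightarrow> 'a \<Rightarrow> 'a) \<Rightarrow> nat \<Rightarrow> nat
    \<Rightarrow> ((nat \<Rightarrow> 'g) \<Rightarrow> 'a) \<Rightarrow> (nat \<Rightarrow> 'g) \<Rightarrow> 'a" where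
  "transposed_cochain G A act n i \<sigma> = (\<lambda>g \<in> tuples G n.
     if i = 1 then \<ominus>\<^bsub>A\<^esub> act (g 1) (\<sigma> (transposed_tuple G n i g))
     else \<ominus>\<^bsub>A\<^esub> \<sigma> (transposed_tuple G n i g))"

text \<open>
  Here \<open>\<phi>\<close> is an action of $\Sigma_{n+1}$ on $C^n(G,A)$ in which the transpositions $(i,i+1)$
  act by the given formulas.
\<close>

definition is_cochain_action ::
  "('g, 'm) monoid_scheme \<Rightarrow> ('a, 'r) ring_scheme \<Rightarrow> ('g \<Rightarrow> 'a \<Rightarrow> 'a) \<Rightarrow> nat
    \<Rightarrow> ((nat \<Rightarrow> nat) \<Rightarrow> ((nat \<Rightarrow> 'g) \<Rightarrow> 'a) \<Rightarrow> (nat \<Rightarrow> 'g) \<Rightarrow> 'a) \<Rightarrow> bool" where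
  "is_cochain_action G A act n \<phi> \<longleftrightarrow>
     group_action (sym_group (n + 1)) (cochains G A n) \<phi> \<and>
     (\<forall>i \<in> {1..n}. \<forall>\<sigma> \<in> cochains G A n.
        \<phi> (transpose i (i + 1)) \<sigma> = transposed_cochain G A act n i \<sigma>)"

end

theory Submission
  imports Defs
begin

text \<open>
  A cochain $\sigma$ corresponds to the homogeneous (that is, $G$-equivariant) cochain
  $F(h_1,\dots,h_{n+1}) = h_1\,\sigma(h_1^{-1}h_2,\dots,h_n^{-1}h_{n+1})$, from which it is
  recovered by evaluating $F$ at the partial products $1, g_1, g_1g_2, \dots$. Under this
  correspondence the given formulas become the restriction to adjacent transpositions of the
  signed permutation action $(pF)(h) = \mathrm{sgn}(p)\,F(h \circ p)$, and the differential
  becomes the alternating sum of the values of $F$ with one argument omitted. If $F$ is alternating,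
  swapping $h_i$ and $h_{i+1}$ exchanges the summands omitting $i$ and $i+1$, which carry opposite
  signs, and negates all the others.
\<close>

section \<open>Adjacent transpositions and finite sums\<close>

text \<open>Permutations of a finite set are products of transpositions, and a transposition of
  \<open>a < b\<close> is a product of adjacent ones supported on \<open>{a..b}\<close>. The form of
  an induction rule serves both uses: equality of two actions and invariance of a cochain.\<close>

lemma adjacent_transpositions_generate:
  fixes n :: nat
  assumes p: "p permutes {1..n + 1}"
    and id: "P id"
    and comp: "\<And>q r. \<lbrakk>q permutes {1..n + 1}; r permutes {1..n + 1}; P q; P r\<rbrakk> \<Longrightarrow> P (q \<circ> r)"
    and adj: "\<And>i. i \<in> {1..n} \<Longrightarrow> P (transpose i (i + 1))"
  shows "P p"
proof -
  \<comment> \<open>The list \<open>xs\<close> holds the lower indices \<open>i\<close> of the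
    factors \<open>(i, i+1)\<close>; the bound \<open>n\<close> on them keeps every factor inside
    \<open>{1..n + 1}\<close>.\<close>
  have seq: "P (apply_adj_transps xs)" if "set xs \<subseteq> {1..n}" for xs
    using that
  proof (induction xs)
    case Nil
    show ?case unfolding apply_adj_transps_Nil by (rule id)
  next
    case (Cons i xs)
    have "transpose i (i + 1) permutes {1..n + 1}"
      using Cons.prems by (intro permutes_swap_id) auto
    moreover have "apply_adj_transps xs permutes {1..n + 1}"
      using Cons.prems by (intro permutes_apply_adj_transps) force
    ultimately show ?case
      unfolding apply_adj_transps_Cons using Cons by (intro comp adj) auto
  qed
  have less: "P (transpose a b)" if "a < b" "a \<in> {1..n + 1}" "b \<in> {1..n + 1}" for a b
  proof -
    have "{a..<b} \<subseteq> {1..n}"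
      using that by auto
    then show ?thesis
      using seq[of "adj_transp_seq a b"] that by (simp add: set_adj_transp_seq adj_transp_seq_correct)
  qed
  have all: "P (transpose a b)" if "a \<in> {1..n + 1}" "b \<in> {1..n + 1}" "a \<noteq> b" for a b
    using less[of a b] less[of b a] that by (metis linorder_neqE_nat transpose_commute)
  from p finite_atLeastAtMost show ?thesis
  proof (induction rule: permutes_induct)
    case id
    show ?case by (rule \<open>P id\<close>)
  next
    case (swap a b q)
    then show ?case
      by (intro comp all permutes_swap_id) auto
  qed
qed

lemma (in abelian_group) finsum_a_inv:
  assumes "f \<in> I \<rightarrow> carrier G"
  shows "(\<Oplus>i\<in>I. \<ominus> f i) = \<ominus> (\<Oplus>i\<in>I. f i)"
proof -
  have "(\<Oplus>i\<in>I. \<ominus> f i) \<oplus> (\<Oplus>i\<in>I. f i) = (\<Oplus>i\<in>I. \<ominus> f i \<oplus> f i)"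
    using assms by (intro finsum_addf[symmetric]) auto
  also have "\<dots> = (\<Oplus>i\<in>I. \<zero>)"
    using assms by (intro finsum_cong') (auto simp: Pi_iff l_neg)
  finally show ?thesis
    using assms by (intro minus_equality[symmetric] finsum_closed) (auto simp: finsum_zero)
qed

text \<open>Bridges the two shapes of the differential: a uniform alternating sum over faces, and a
  formula with separate first and last terms.\<close>

lemma (in abelian_monoid) finsum_split_ends:
  fixes n :: nat
  assumes f: "f \<in> {0..n + 1} \<rightarrow> carrier G"
  shows "(\<Oplus>j\<in>{0..n + 1}. f j) = f 0 \<oplus> (\<Oplus>j\<in>{1..n}. f j) \<oplus> f (n + 1)"
proof -
  have f': "f 0 \<in> carrier G" "f (n + 1) \<in> carrier G" "f \<in> {1..n} \<rightarrow> carrier G"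
    using f by auto
  have "{0..n + 1} = insert (n + 1) (insert 0 {1..n})"
    by auto
  then have "(\<Oplus>j\<in>{0..n + 1}. f j) = (\<Oplus>j\<in>insert (n + 1) (insert 0 {1..n}). f j)"
    by (simp only:)
  also have "\<dots> = f (n + 1) \<oplus> (f 0 \<oplus> (\<Oplus>j\<in>{1..n}. f j))"
    using f' by (subst finsum_insert; auto simp: finsum_insert)
  also have "\<dots> = f 0 \<oplus> (\<Oplus>j\<in>{1..n}. f j) \<oplus> f (n + 1)"
    using f' by (intro a_comm a_closed finsum_closed)
  finally show ?thesis .
qed

section \<open>Additivity of the module action\<close>

context gmodule
begin

text \<open>Rewriting with \<open>m_assoc\<close> nests products to the right, where an element and
  its inverse meet only in these two patterns.\<close>

lemma cancel_inv:
  assumes "x \<in> carrier G" "y \<in> carrier G"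
  shows "x \<otimes>\<^bsub>G\<^esub> (inv\<^bsub>G\<^esub> x \<otimes>\<^bsub>G\<^esub> y) = y" "inv\<^bsub>G\<^esub> x \<otimes>\<^bsub>G\<^esub> (x \<otimes>\<^bsub>G\<^esub> y) = y"
  using assms by (simp_all flip: m_assoc)

lemma act_closed [simp]: "\<lbrakk>g \<in> carrier G; x \<in> carrier A\<rbrakk> \<Longrightarrow> act g x \<in> carrier A"
  using element_image by blast

lemma act_one [simp]: "x \<in> carrier A \<Longrightarrow> act \<one>\<^bsub>G\<^esub> x = x"
  by (metis id_eq_one restrict_apply)

lemma act_mult:
  "\<lbrakk>g \<in> carrier G; h \<in> carrier G; x \<in> carrier A\<rbrakk> \<Longrightarrow> act (g \<otimes>\<^bsub>G\<^esub> h) x = act g (act h x)"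
  by (rule composition_rule)

lemma act_hom: "g \<in> carrier G \<Longrightarrow> act g \<in> hom (add_monoid A) (add_monoid A)"
  by (simp add: hom_def act_add)

lemma act_add_pow:
  fixes k :: int
  assumes "g \<in> carrier G" "x \<in> carrier A"
  shows "act g ([k] \<cdot>\<^bsub>A\<^esub> x) = [k] \<cdot>\<^bsub>A\<^esub> act g x"
  using hom_int_pow[OF act_hom[OF assms(1)] _ A.a_group A.a_group, of x k] assms(2)
  by (simp add: add_pow_def)

lemma act_zero: "g \<in> carrier G \<Longrightarrow> act g \<zero>\<^bsub>A\<^esub> = \<zero>\<^bsub>A\<^esub>"
  using hom_one[OF act_hom A.a_group A.a_group] by simp

lemma act_finsum:
  assumes "g \<in> carrier G" "finite I" "f \<in> I \<rightarrow> carrier A"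
  shows "act g (\<Oplus>\<^bsub>A\<^esub>i\<in>I. f i) = (\<Oplus>\<^bsub>A\<^esub>i\<in>I. act g (f i))"
  using assms(2,3)
proof (induction I)
  case empty
  then show ?case by (simp add: act_zero assms(1))
next
  case (insert i I)
  have "(\<lambda>i. act g (f i)) \<in> I \<rightarrow> carrier A"
    using insert.prems assms(1) by (simp add: Pi_iff)
  then show ?case
    using insert assms(1) by (simp add: A.finsum_insert act_add Pi_iff)
qed

section \<open>Homogeneous and inhomogeneous coordinates\<close>

definition differences :: "nat \<Rightarrow> (nat \<Rightarrow> 'g) \<Rightarrow> nat \<Rightarrow> 'g" where
  "differences n h = (\<lambda>k \<in> {1..n}. inv\<^bsub>G\<^esub> h k \<otimes>\<^bsub>G\<^esub> h (k + 1))"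

text \<open>The argument \<open>h\<close> is any function on the naturals, not an extensional tuple,
  so that composites \<open>h \<circ> p\<close> and translates can be inserted directly; only its
  values on \<open>{1..n + 1}\<close> matter.\<close>

definition homogeneous :: "nat \<Rightarrow> ((nat \<Rightarrow> 'g) \<Rightarrow> 'a) \<Rightarrow> (nat \<Rightarrow> 'g) \<Rightarrow> 'a" where
  "homogeneous n \<sigma> h = act (h 1) (\<sigma> (differences n h))"

text \<open>The tuple $1, g_1, g_1g_2, \dots$ starts at index 1; the value at 0 is junk.\<close>

fun partial_products :: "(nat \<Rightarrow> 'g) \<Rightarrow> nat \<Rightarrow> 'g" where
  "partial_products g 0 = \<one>\<^bsub>G\<^esub>"
| "partial_products g (Suc 0) = \<one>\<^bsub>G\<^esub>"
| "partial_products g (Suc (Suc k)) = partial_products g (Suc k) \<otimes>\<^bsub>G\<^esub> g (Suc k)"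

text \<open>The signed permutation action on homogeneous cochains, read off at the tuple of partial
  products. The restriction to \<open>cochains G A n\<close> is there because elements of
  \<open>BijGroup\<close> are extensional functions.\<close>

definition perm_cochain ::
  "nat \<Rightarrow> (nat \<Rightarrow> nat) \<Rightarrow> ((nat \<Rightarrow> 'g) \<Rightarrow> 'a) \<Rightarrow> (nat \<Rightarrow> 'g) \<Rightarrow> 'a" where
  "perm_cochain n p = (\<lambda>\<sigma> \<in> cochains G A n. \<lambda>g \<in> tuples G n.
     [sign p] \<cdot>\<^bsub>A\<^esub> homogeneous n \<sigma> (partial_products g \<circ> p))"

lemma cochain_closed: "\<lbrakk>\<sigma> \<in> cochains G A n; g \<in> tuples G n\<rbrakk> \<Longrightarrow> \<sigma> g \<in> carrier A"
  by (auto simp: cochains_def)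

lemma differences_closed: "h \<in> {1..n + 1} \<rightarrow> carrier G \<Longrightarrow> differences n h \<in> tuples G n"
  unfolding differences_def tuples_def
  by (intro restrict_PiE_iff[THEN iffD2] ballI m_closed inv_closed; erule funcset_mem) auto

lemma partial_products_closed:
  assumes "g \<in> tuples G n"
  shows "partial_products g \<in> {1..n + 1} \<rightarrow> carrier G"
proof -
  have "k \<le> n + 1 \<Longrightarrow> partial_products g k \<in> carrier G" for k
    using assms by (induction g k rule: partial_products.induct) (auto simp: tuples_def)
  then show ?thesis by auto
qed

lemma homogeneous_closed:
  assumes "\<sigma> \<in> cochains G A n" "h \<in> {1..n + 1} \<rightarrow> carrier G"
  shows "homogeneous n \<sigma> h \<in> carrier A"
  unfolding homogeneous_def
  using assms(2) cochain_closed[OF assms(1) differences_closed[OF assms(2)]] by (intro act_closed) auto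

lemma homogeneous_cong:
  assumes "\<And>k. k \<in> {1..n + 1} \<Longrightarrow> h k = h' k"
  shows "homogeneous n \<sigma> h = homogeneous n \<sigma> h'"
proof -
  have "differences n h = differences n h'"
    unfolding differences_def using assms by (intro restrict_ext) auto
  then show ?thesis
    using assms[of 1] by (simp add: homogeneous_def)
qed

text \<open>A common left factor cancels in every quotient of neighbouring entries and survives only
  in the first entry, which acts from outside. This is the equivariance of homogeneous
  cochains.\<close>

lemma homogeneous_translate:
  assumes "\<sigma> \<in> cochains G A n" "h \<in> {1..n + 1} \<rightarrow> carrier G" "x \<in> carrier G"
  shows "homogeneous n \<sigma> (\<lambda>k. x \<otimes>\<^bsub>G\<^esub> h k) = act x (homogeneous n \<sigma> h)"
proof -
  have "differences n (\<lambda>k. x \<otimes>\<^bsub>G\<^esub> h k) = differences n h"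
    unfolding differences_def
  proof (rule restrict_ext)
    fix k assume "k \<in> {1..n}"
    then have "h k \<in> carrier G" "h (k + 1) \<in> carrier G"
      using assms(2) by auto
    then show "inv\<^bsub>G\<^esub> (x \<otimes>\<^bsub>G\<^esub> h k) \<otimes>\<^bsub>G\<^esub> (x \<otimes>\<^bsub>G\<^esub> h (k + 1)) = inv\<^bsub>G\<^esub> h k \<otimes>\<^bsub>G\<^esub> h (k + 1)"
      using assms(3) by (simp add: inv_mult_group cancel_inv m_assoc)
  qed
  moreover have "h 1 \<in> carrier G"
    using assms(2) by auto
  ultimately show ?thesis
    using assms by (simp add: homogeneous_def act_mult cochain_closed differences_closed)
qed

text \<open>The product of the quotients telescopes. The tuple \<open>h\<close> is thus recovered
  only up to a left translation, which \<open>homogeneous_translate\<close> accounts for.\<close>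

lemma partial_products_differences:
  assumes "h \<in> {1..n + 1} \<rightarrow> carrier G" "k \<in> {1..n + 1}"
  shows "partial_products (differences n h) k = inv\<^bsub>G\<^esub> h 1 \<otimes>\<^bsub>G\<^esub> h k"
proof -
  \<comment> \<open>Induction runs over \<open>Suc k\<close>, since the tuple of partial products
    begins at index 1.\<close>
  have "Suc k \<le> n + 1 \<Longrightarrow> partial_products (differences n h) (Suc k) = inv\<^bsub>G\<^esub> h 1 \<otimes>\<^bsub>G\<^esub> h (Suc k)" for k
  proof (induction k)
    case 0
    then show ?case using assms(1) by (auto simp: Pi_iff)
  next
    case (Suc k)
    then have "h 1 \<in> carrier G" "h (Suc k) \<in> carrier G" "h (Suc (Suc k)) \<in> carrier G"
      using assms(1) by auto
    then show ?case
      using Suc by (simp add: differences_def m_assoc cancel_inv)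
  qed
  moreover obtain m where "k = Suc m"
    using assms(2) by (cases k) auto
  ultimately show ?thesis
    using assms(2) by simp
qed

lemma differences_partial_products:
  assumes "g \<in> tuples G n"
  shows "differences n (partial_products g) = g"
proof
  fix k
  show "differences n (partial_products g) k = g k"
  proof (cases "k \<in> {1..n}")
    case True
    then obtain m where m: "k = Suc m" by (cases k) auto
    have "partial_products g (Suc m) \<in> carrier G" "g (Suc m) \<in> carrier G"
      using True m partial_products_closed[OF assms] assms by (auto simp: tuples_def)
    then show ?thesis
      using True by (simp add: differences_def m cancel_inv)
  next
    case False
    then show ?thesis
      using assms by (auto simp: differences_def tuples_def)
  qed
qed

section \<open>The signed permutation action\<close>

lemma permuted_closed:
  assumes "h \<in> {1..m} \<rightarrow> carrier G" "p permutes {1..m}"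
  shows "h \<circ> p \<in> {1..m} \<rightarrow> carrier G"
  using assms permutes_in_image[OF assms(2)] by (auto simp: Pi_iff)

lemma perm_cochain_closed:
  assumes "\<sigma> \<in> cochains G A n" "p permutes {1..n + 1}"
  shows "perm_cochain n p \<sigma> \<in> cochains G A n"
proof -
  have "[sign p] \<cdot>\<^bsub>A\<^esub> homogeneous n \<sigma> (partial_products g \<circ> p) \<in> carrier A"
    if "g \<in> tuples G n" for g
    using assms that
    by (intro A.add.int_pow_closed homogeneous_closed permuted_closed partial_products_closed)
  then show ?thesis
    using assms(1) by (simp add: perm_cochain_def cochains_def[of G A n])
qed

text \<open>Extends the defining formula from tuples that start with the unit to arbitrary
  \<open>h\<close>: normalising \<open>h\<close> translates it by the inverse of \<open>h 1\<close>,
  equivariance moves that factor outside, and there the action of \<open>h 1\<close> cancels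
  it.\<close>

lemma homogeneous_perm_cochain:
  assumes \<sigma>: "\<sigma> \<in> cochains G A n" and p: "p permutes {1..n + 1}"
    and h: "h \<in> {1..n + 1} \<rightarrow> carrier G"
  shows "homogeneous n (perm_cochain n p \<sigma>) h = [sign p] \<cdot>\<^bsub>A\<^esub> homogeneous n \<sigma> (h \<circ> p)"
proof -
  have h1: "h 1 \<in> carrier G"
    using h by auto
  have hp: "h \<circ> p \<in> {1..n + 1} \<rightarrow> carrier G"
    using h p by (rule permuted_closed)
  have "homogeneous n \<sigma> (partial_products (differences n h) \<circ> p)
      = homogeneous n \<sigma> (\<lambda>k. inv\<^bsub>G\<^esub> h 1 \<otimes>\<^bsub>G\<^esub> (h \<circ> p) k)"
    unfolding o_def
    by (intro homogeneous_cong partial_products_differences h) (use permutes_in_image[OF p] in blast)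
  also have "\<dots> = act (inv\<^bsub>G\<^esub> h 1) (homogeneous n \<sigma> (h \<circ> p))"
    using \<sigma> hp h1 by (intro homogeneous_translate) auto
  finally have "homogeneous n (perm_cochain n p \<sigma>) h
      = act (h 1) ([sign p] \<cdot>\<^bsub>A\<^esub> act (inv\<^bsub>G\<^esub> h 1) (homogeneous n \<sigma> (h \<circ> p)))"
    using \<sigma> differences_closed[OF h]
    unfolding homogeneous_def[of n "perm_cochain n p \<sigma>"] by (simp add: perm_cochain_def)
  also have "\<dots> = [sign p] \<cdot>\<^bsub>A\<^esub> homogeneous n \<sigma> (h \<circ> p)"
    using h1 homogeneous_closed[OF \<sigma> hp] by (simp add: act_add_pow flip: act_mult)
  finally show ?thesis .
qed

text \<open>Precomposing the argument first with \<open>p\<close> and then with \<open>q\<close>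
  gives \<open>h \<circ> (p \<circ> q)\<close>, so the order of the factors is kept and the action
  is a left one. As \<open>partial_products g \<circ> p\<close> need not start with the unit,
  \<open>homogeneous_perm_cochain\<close> is applied in its general form.\<close>

lemma perm_cochain_compose:
  assumes \<sigma>: "\<sigma> \<in> cochains G A n" and p: "p permutes {1..n + 1}" and q: "q permutes {1..n + 1}"
  shows "perm_cochain n (p \<circ> q) \<sigma> = perm_cochain n p (perm_cochain n q \<sigma>)"
proof -
  have sgn: "sign (p \<circ> q) = sign q * sign p"
    using p q by (simp add: sign_compose permutes_imp_permutation[of "{1..n + 1}"])
  have "[sign (p \<circ> q)] \<cdot>\<^bsub>A\<^esub> homogeneous n \<sigma> (partial_products g \<circ> (p \<circ> q))
      = [sign p] \<cdot>\<^bsub>A\<^esub> homogeneous n (perm_cochain n q \<sigma>) (partial_products g \<circ> p)"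
    if "g \<in> tuples G n" for g
  proof -
    have gp: "partial_products g \<circ> p \<in> {1..n + 1} \<rightarrow> carrier G"
      using that p by (intro permuted_closed partial_products_closed)
    then show ?thesis
      using homogeneous_closed[OF \<sigma> permuted_closed[OF gp q]]
      by (simp add: homogeneous_perm_cochain[OF \<sigma> q gp] sgn A.add.int_pow_pow o_assoc)
  qed
  then show ?thesis
    using \<sigma> perm_cochain_closed[OF \<sigma> q] by (simp add: perm_cochain_def cong: restrict_cong)
qed

lemma perm_cochain_id:
  assumes "\<sigma> \<in> cochains G A n"
  shows "perm_cochain n id \<sigma> = \<sigma>"
proof -
  have "perm_cochain n id \<sigma> = restrict \<sigma> (tuples G n)"
    unfolding perm_cochain_def using assms
    by (auto intro!: restrict_ext
        simp: homogeneous_def differences_partial_products cochain_closed)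
  also have "\<dots> = \<sigma>"
    using assms unfolding cochains_def by (rule PiE_restrict)
  finally show ?thesis .
qed

lemma perm_cochain_Bij:
  assumes "p permutes {1..n + 1}"
  shows "perm_cochain n p \<in> Bij (cochains G A n)"
proof -
  have inv: "inv' p permutes {1..n + 1}"
    using assms by (rule permutes_inv)
  have "bij_betw (perm_cochain n p) (cochains G A n) (cochains G A n)"
    using assms inv
    by (intro bij_betw_byWitness[where f' = "perm_cochain n (inv' p)"])
      (auto simp: perm_cochain_id perm_cochain_closed permutes_inv_o
        simp flip: perm_cochain_compose)
  then show ?thesis
    by (simp add: Bij_def perm_cochain_def)
qed

lemma group_action_perm_cochain:
  "group_action (sym_group (n + 1)) (cochains G A n) (perm_cochain n)"
proof -
  have "perm_cochain n \<in> hom (sym_group (n + 1)) (BijGroup (cochains G A n))"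
  proof (rule homI)
    fix p assume "p \<in> carrier (sym_group (n + 1))"
    then show "perm_cochain n p \<in> carrier (BijGroup (cochains G A n))"
      by (simp add: sym_group_carrier perm_cochain_Bij BijGroup_def)
  next
    fix p q assume "p \<in> carrier (sym_group (n + 1))" "q \<in> carrier (sym_group (n + 1))"
    then have pq: "p permutes {1..n + 1}" "q permutes {1..n + 1}"
      by (simp_all add: sym_group_carrier)
    \<comment> \<open>An equality of functions on all arguments: outside the cochains both sides are
      \<open>undefined\<close>.\<close>
    have "perm_cochain n (p \<circ> q) = compose (cochains G A n) (perm_cochain n p) (perm_cochain n q)"
    proof
      fix \<sigma>
      show "perm_cochain n (p \<circ> q) \<sigma> = compose (cochains G A n) (perm_cochain n p) (perm_cochain n q) \<sigma>"
        using perm_cochain_compose[OF _ pq, of \<sigma>]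
        by (cases "\<sigma> \<in> cochains G A n") (auto simp: compose_def perm_cochain_def)
    qed
    then show "perm_cochain n (p \<otimes>\<^bsub>sym_group (n + 1)\<^esub> q)
        = perm_cochain n p \<otimes>\<^bsub>BijGroup (cochains G A n)\<^esub> perm_cochain n q"
      using pq by (simp add: sym_group_mult BijGroup_def perm_cochain_Bij)
  qed
  then show ?thesis
    by (intro group_action.intro group_hom.intro group_hom_axioms.intro
        sym_group_is_group group_BijGroup)
qed

section \<open>Agreement with the given formulas, and uniqueness\<close>

text \<open>Swapping the partial products at \<open>i\<close> and \<open>i + 1\<close> affects only
  the quotients at \<open>i - 1\<close>, \<open>i\<close> and \<open>i + 1\<close>, which become the
  three modified entries of \<open>transposed_tuple\<close>. The minus sign is the sign of a
  transposition.\<close>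

lemma perm_cochain_transpose:
  assumes \<sigma>: "\<sigma> \<in> cochains G A n" and i: "i \<in> {1..n}"
  shows "perm_cochain n (transpose i (i + 1)) \<sigma> = transposed_cochain G A act n i \<sigma>"
proof -
  let ?t = "transpose i (i + 1)"
  have perm: "?t permutes {1..n + 1}"
    using i by (intro permutes_swap_id) auto
  have "[sign ?t] \<cdot>\<^bsub>A\<^esub> homogeneous n \<sigma> (partial_products g \<circ> ?t)
      = (if i = 1 then \<ominus>\<^bsub>A\<^esub> act (g 1) (\<sigma> (transposed_tuple G n i g))
         else \<ominus>\<^bsub>A\<^esub> \<sigma> (transposed_tuple G n i g))"
    if g: "g \<in> tuples G n" for g
  proof -
    let ?h = "partial_products g"
    have h: "k \<in> {1..n + 1} \<Longrightarrow> ?h k \<in> carrier G" for k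
      using partial_products_closed[OF g] by auto
    have gk: "k \<in> {1..n} \<Longrightarrow> g k \<in> carrier G" for k
      using g by (auto simp: tuples_def)
    \<comment> \<open>The range starts at 1 because the recursion equation has no such form at index
      0.\<close>
    have step: "?h (Suc k) = ?h k \<otimes>\<^bsub>G\<^esub> g k" if "k \<in> {1..n}" for k
      using that by (cases k) auto
    have diff: "differences n (?h \<circ> ?t) = transposed_tuple G n i g"
      unfolding differences_def transposed_tuple_def
    proof (rule restrict_ext)
      fix k assume k: "k \<in> {1..n}"
      consider "k + 1 = i" | "k = i" | "k = i + 1" | "k + 1 \<noteq> i" "k \<noteq> i" "k \<noteq> i + 1" by blast
      then show "inv\<^bsub>G\<^esub> (?h \<circ> ?t) k \<otimes>\<^bsub>G\<^esub> (?h \<circ> ?t) (k + 1)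
          = (if k + 1 = i then g k \<otimes>\<^bsub>G\<^esub> g i else if k = i then inv\<^bsub>G\<^esub> g i
             else if k = i + 1 then g i \<otimes>\<^bsub>G\<^esub> g k else g k)"
      proof cases
        case 1
        then show ?thesis
          using k i h[of k] gk[of k] gk[of i] step[of k] step[of i]
          by (auto simp: transpose_def cancel_inv m_assoc)
      next
        case 2
        then show ?thesis
          using k i h[of i] gk[of i] step[of i]
          by (auto simp: transpose_def inv_mult_group m_assoc)
      next
        case 3
        then show ?thesis
          using k i h[of i] gk[of i] gk[of k] step[of i] step[of k]
          by (auto simp: transpose_def cancel_inv m_assoc)
      next
        case 4
        then show ?thesis
          using k i h[of k] gk[of k] step[of k]
          by (auto simp: transpose_def cancel_inv)
      qed
    qed
    have sgn: "sign ?t = - 1"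
      by (simp add: sign_swap_id)
    \<comment> \<open>This accounts for the extra action of \<open>g 1\<close> in the case
      \<open>i = 1\<close>: only then does the swap move the leading unit, replacing it by the
      second partial product.\<close>
    have first: "(?h \<circ> ?t) 1 = (if i = 1 then g 1 else \<one>\<^bsub>G\<^esub>)"
      using i gk[of 1] by (auto simp: transpose_def numeral_2_eq_2)
    have tt: "transposed_tuple G n i g \<in> tuples G n"
      unfolding diff[symmetric]
      by (intro differences_closed permuted_closed partial_products_closed g perm)
    then show ?thesis
      using i gk[of 1] cochain_closed[OF \<sigma> tt]
      unfolding homogeneous_def diff sgn first by (simp add: A.add.int_pow_neg)
  qed
  then show ?thesis
    using \<sigma> by (simp add: perm_cochain_def transposed_cochain_def cong: restrict_cong)
qed

lemma is_cochain_action_perm_cochain: "is_cochain_action G A act n (perm_cochain n)"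
  by (simp add: is_cochain_action_def group_action_perm_cochain[simplified] perm_cochain_transpose[simplified])

text \<open>Two homomorphisms that agree on the generating adjacent transpositions agree
  everywhere.\<close>

lemma cochain_action_unique:
  assumes \<phi>: "is_cochain_action G A act n \<phi>" and \<psi>: "is_cochain_action G A act n \<psi>"
    and p: "p \<in> carrier (sym_group (n + 1))"
  shows "\<phi> p = \<psi> p"
proof -
  interpret \<phi>: group_action "sym_group (n + 1)" "cochains G A n" \<phi>
    using \<phi> by (simp add: is_cochain_action_def)
  interpret \<psi>: group_action "sym_group (n + 1)" "cochains G A n" \<psi>
    using \<psi> by (simp add: is_cochain_action_def)
  have "p permutes {1..n + 1}"
    using p by (simp add: sym_group_carrier)
  then show ?thesis
  proof (rule adjacent_transpositions_generate)
    show "\<phi> id = \<psi> id"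
      using \<phi>.id_eq_one \<psi>.id_eq_one by (simp add: sym_group_one)
  next
    fix q r
    assume "q permutes {1..n + 1}" "r permutes {1..n + 1}" and eq: "\<phi> q = \<psi> q" "\<phi> r = \<psi> r"
    then have c: "q \<in> carrier (sym_group (n + 1))" "r \<in> carrier (sym_group (n + 1))"
      by (simp_all add: sym_group_carrier)
    show "\<phi> (q \<circ> r) = \<psi> (q \<circ> r)"
      using group_hom.hom_mult[OF \<phi>.group_hom c] group_hom.hom_mult[OF \<psi>.group_hom c] eq
      by (simp add: sym_group_mult)
  next
    fix i assume i: "i \<in> {1..n}"
    then have "transpose i (i + 1) permutes {1..n + 1}"
      by (intro permutes_swap_id) auto
    then have c: "transpose i (i + 1) \<in> carrier (sym_group (n + 1))"
      by (simp add: sym_group_carrier)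
    show "\<phi> (transpose i (i + 1)) = \<psi> (transpose i (i + 1))"
    \<comment> \<open>The prescribed formulas fix the values on cochains only; extensionality
      upgrades this to equality of functions.\<close>
    proof (rule extensionalityI)
      show "\<phi> (transpose i (i + 1)) \<in> extensional (cochains G A n)"
        using \<phi>.bij_prop0[OF c] by (rule Bij_imp_extensional)
      show "\<psi> (transpose i (i + 1)) \<in> extensional (cochains G A n)"
        using \<psi>.bij_prop0[OF c] by (rule Bij_imp_extensional)
    qed (use \<phi> \<psi> i in \<open>simp add: is_cochain_action_def\<close>)
  qed
qed

section \<open>The differential as an alternating sum over faces\<close>

text \<open>The face map of the simplex with vertices \<open>h\<close>, numbered from 1.\<close>

definition omit :: "nat \<Rightarrow> (nat \<Rightarrow> 'g) \<Rightarrow> nat \<Rightarrow> 'g" where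
  "omit j h k = (if k < j then h k else h (k + 1))"

lemma omit_closed: "h \<in> {1..n + 2} \<rightarrow> carrier G \<Longrightarrow> omit j h \<in> {1..n + 1} \<rightarrow> carrier G"
  by (auto simp: omit_def Pi_iff)

lemma coboundary_closed:
  assumes \<sigma>: "\<sigma> \<in> cochains G A n"
  shows "coboundary G A act n \<sigma> \<in> cochains G A (n + 1)"
  unfolding coboundary_def cochains_def[of G A "n + 1"]
proof (rule restrict_PiE_iff[THEN iffD2], rule ballI)
  fix g assume g: "g \<in> tuples G (n + 1)"
  have gk: "g k \<in> carrier G" if "k \<in> {1..n + 1}" for k
    using g that by (auto simp: tuples_def)
  have first: "(\<lambda>k \<in> {1..n}. g (k + 1)) \<in> tuples G n"
    unfolding tuples_def by (auto intro!: gk)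
  have inner: "(\<lambda>k \<in> {1..n}. if k < j then g k
      else if k = j then g j \<otimes>\<^bsub>G\<^esub> g (j + 1) else g (k + 1)) \<in> tuples G n" for j
    unfolding tuples_def by (auto intro!: gk m_closed)
  have last: "(\<lambda>k \<in> {1..n}. g k) \<in> tuples G n"
    unfolding tuples_def by (auto intro!: gk)
  show "act (g 1) (\<sigma> (\<lambda>k \<in> {1..n}. g (k + 1)))
     \<oplus>\<^bsub>A\<^esub> (\<Oplus>\<^bsub>A\<^esub>j \<in> {1..n}. [((-1) ^ j :: int)] \<cdot>\<^bsub>A\<^esub>
          \<sigma> (\<lambda>k \<in> {1..n}. if k < j then g k else if k = j then g j \<otimes>\<^bsub>G\<^esub> g (j + 1) else g (k + 1)))
     \<oplus>\<^bsub>A\<^esub> [((-1) ^ (n + 1) :: int)] \<cdot>\<^bsub>A\<^esub> \<sigma> (\<lambda>k \<in> {1..n}. g k) \<in> carrier A"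
    using cochain_closed[OF \<sigma> first] cochain_closed[OF \<sigma> inner] cochain_closed[OF \<sigma> last] gk[of 1]
    by (intro A.a_closed act_closed A.finsum_closed A.add.int_pow_closed Pi_I) auto
qed

lemma differences_omit_first:
  "differences n (omit 1 h) = (\<lambda>k \<in> {1..n}. differences (n + 1) h (k + 1))"
  unfolding differences_def by (intro restrict_ext) (auto simp: omit_def)

text \<open>Removing vertex \<open>j + 1\<close> merges the two quotients that meet there into their
  product. Hence summand \<open>j\<close> of the differential belongs to the omitted index
  \<open>j + 1\<close>.\<close>

lemma differences_omit_inner:
  assumes h: "h \<in> {1..n + 2} \<rightarrow> carrier G" and j: "j \<in> {1..n}"
  shows "differences n (omit (j + 1) h)
    = (\<lambda>k \<in> {1..n}. if k < j then differences (n + 1) h k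
        else if k = j then differences (n + 1) h j \<otimes>\<^bsub>G\<^esub> differences (n + 1) h (j + 1)
        else differences (n + 1) h (k + 1))"
  unfolding differences_def[of n]
proof (rule restrict_ext)
  fix k assume k: "k \<in> {1..n}"
  have "h j \<in> carrier G" "h (j + 1) \<in> carrier G" "h (j + 2) \<in> carrier G"
    using h j by auto
  then have "inv\<^bsub>G\<^esub> h j \<otimes>\<^bsub>G\<^esub> h (j + 2)
      = inv\<^bsub>G\<^esub> h j \<otimes>\<^bsub>G\<^esub> h (j + 1) \<otimes>\<^bsub>G\<^esub> (inv\<^bsub>G\<^esub> h (j + 1) \<otimes>\<^bsub>G\<^esub> h (j + 2))"
    by (simp add: m_assoc cancel_inv)
  then show "inv\<^bsub>G\<^esub> omit (j + 1) h k \<otimes>\<^bsub>G\<^esub> omit (j + 1) h (k + 1)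
      = (if k < j then differences (n + 1) h k
        else if k = j then differences (n + 1) h j \<otimes>\<^bsub>G\<^esub> differences (n + 1) h (j + 1)
        else differences (n + 1) h (k + 1))"
    using k j by (auto simp: omit_def differences_def)
qed

lemma differences_omit_last:
  "differences n (omit (n + 2) h) = (\<lambda>k \<in> {1..n}. differences (n + 1) h k)"
  unfolding differences_def by (intro restrict_ext) (auto simp: omit_def)

text \<open>The action of \<open>h 1\<close> distributes over the summands of the differential, and
  each becomes the value of the homogeneous cochain at one face.\<close>

lemma homogeneous_coboundary:
  assumes \<sigma>: "\<sigma> \<in> cochains G A n" and h: "h \<in> {1..n + 2} \<rightarrow> carrier G"
  shows "homogeneous (n + 1) (coboundary G A act n \<sigma>) h
    = (\<Oplus>\<^bsub>A\<^esub>j\<in>{0..n + 1}. [((-1) ^ j :: int)] \<cdot>\<^bsub>A\<^esub> homogeneous n \<sigma> (omit (j + 1) h))"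
proof -
  let ?g = "differences (n + 1) h"
  let ?x = "\<lambda>j. \<sigma> (differences n (omit j h))"
  let ?F = "\<lambda>j. [((-1) ^ j :: int)] \<cdot>\<^bsub>A\<^esub> homogeneous n \<sigma> (omit (j + 1) h)"
  have x: "?x j \<in> carrier A" for j
    using h by (intro cochain_closed[OF \<sigma>] differences_closed omit_closed)
  have F: "?F j \<in> carrier A" for j
    using \<sigma> h by (intro A.add.int_pow_closed homogeneous_closed omit_closed)
  have h12: "h 1 \<in> carrier G" "h 2 \<in> carrier G"
    using h by auto
  have g: "?g \<in> tuples G (n + 1)"
    using h by (intro differences_closed) simp
  have g1: "?g 1 = inv\<^bsub>G\<^esub> h 1 \<otimes>\<^bsub>G\<^esub> h 2"
    by (simp add: differences_def numeral_2_eq_2)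
  \<comment> \<open>The face without vertex 1 begins with \<open>h 2\<close>, which is exactly the
    product of \<open>h 1\<close> and the first quotient.\<close>
  have F0: "act (h 1) (act (?g 1) (?x 1)) = ?F 0"
  proof -
    have "act (h 1) (act (?g 1) (?x 1)) = act (h 2) (?x 1)"
      unfolding g1 using h12 x[of 1] by (simp add: cancel_inv flip: act_mult)
    also have "\<dots> = ?F 0"
      using h12 x[of 1] by (simp add: homogeneous_def omit_def numeral_2_eq_2)
    finally show ?thesis .
  qed
  \<comment> \<open>For \<open>j >= 1\<close> the omitted vertex is not the first, so the face still
    begins with \<open>h 1\<close>.\<close>
  have FS: "act (h 1) ([((-1) ^ j :: int)] \<cdot>\<^bsub>A\<^esub> ?x (j + 1)) = ?F j" if "j \<ge> 1" for j
    using that h12 x[of "j + 1"] by (simp add: homogeneous_def omit_def act_add_pow)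
  have "coboundary G A act n \<sigma> ?g = act (?g 1) (?x 1)
     \<oplus>\<^bsub>A\<^esub> (\<Oplus>\<^bsub>A\<^esub>j \<in> {1..n}. [((-1) ^ j :: int)] \<cdot>\<^bsub>A\<^esub> ?x (j + 1))
     \<oplus>\<^bsub>A\<^esub> [((-1) ^ (n + 1) :: int)] \<cdot>\<^bsub>A\<^esub> ?x (n + 2)"
  proof -
    have "(\<Oplus>\<^bsub>A\<^esub>j \<in> {1..n}. [((-1) ^ j :: int)] \<cdot>\<^bsub>A\<^esub> ?x (j + 1))
      = (\<Oplus>\<^bsub>A\<^esub>j \<in> {1..n}. [((-1) ^ j :: int)] \<cdot>\<^bsub>A\<^esub> \<sigma> (\<lambda>k \<in> {1..n}. if k < j then ?g k
          else if k = j then ?g j \<otimes>\<^bsub>G\<^esub> ?g (j + 1) else ?g (k + 1)))"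
    proof (rule A.finsum_cong'[symmetric])
      show "(\<lambda>j. [((-1) ^ j :: int)] \<cdot>\<^bsub>A\<^esub> ?x (j + 1)) \<in> {1..n} \<rightarrow> carrier A"
        using x by simp
    qed (simp_all only: differences_omit_inner[OF h])
    then show ?thesis
      unfolding coboundary_def differences_omit_first differences_omit_last
      by (simp only: restrict_apply'[OF g])
  qed
  then have "homogeneous (n + 1) (coboundary G A act n \<sigma>) h
    = act (h 1) (act (?g 1) (?x 1)
     \<oplus>\<^bsub>A\<^esub> (\<Oplus>\<^bsub>A\<^esub>j \<in> {1..n}. [((-1) ^ j :: int)] \<cdot>\<^bsub>A\<^esub> ?x (j + 1))
     \<oplus>\<^bsub>A\<^esub> [((-1) ^ (n + 1) :: int)] \<cdot>\<^bsub>A\<^esub> ?x (n + 2))"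
    by (simp only: homogeneous_def)
  also have "\<dots> = act (h 1) (act (?g 1) (?x 1))
     \<oplus>\<^bsub>A\<^esub> (\<Oplus>\<^bsub>A\<^esub>j \<in> {1..n}. act (h 1) ([((-1) ^ j :: int)] \<cdot>\<^bsub>A\<^esub> ?x (j + 1)))
     \<oplus>\<^bsub>A\<^esub> act (h 1) ([((-1) ^ (n + 1) :: int)] \<cdot>\<^bsub>A\<^esub> ?x (n + 2))"
    using h12 x g1 by (simp add: act_add act_finsum Pi_iff A.finsum_closed)
  also have "\<dots> = ?F 0 \<oplus>\<^bsub>A\<^esub> (\<Oplus>\<^bsub>A\<^esub>j \<in> {1..n}. ?F j) \<oplus>\<^bsub>A\<^esub> ?F (n + 1)"
  proof -
    have "(\<Oplus>\<^bsub>A\<^esub>j \<in> {1..n}. act (h 1) ([((-1) ^ j :: int)] \<cdot>\<^bsub>A\<^esub> ?x (j + 1))) = (\<Oplus>\<^bsub>A\<^esub>j \<in> {1..n}. ?F j)"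
      using F FS by (intro A.finsum_cong') auto
    then show ?thesis
      using F0 FS[of "n + 1"] by simp
  qed
  also have "\<dots> = (\<Oplus>\<^bsub>A\<^esub>j\<in>{0..n + 1}. ?F j)"
    using F by (intro A.finsum_split_ends[symmetric]) simp
  finally show ?thesis .
qed

section \<open>Invariance of the coboundary\<close>

text \<open>Omitting an earlier entry moves the two swapped entries down by one place.\<close>

lemma omit_transpose_before:
  assumes "j < i"
  shows "omit j (h \<circ> transpose i (i + 1)) = omit j h \<circ> transpose (i - 1) i"
  using assms by (auto simp: omit_def transpose_def fun_eq_iff)

lemma omit_transpose_after:
  assumes "i + 1 < j"
  shows "omit j (h \<circ> transpose i (i + 1)) = omit j h \<circ> transpose i (i + 1)"
  using assms by (auto simp: omit_def transpose_def fun_eq_iff)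

lemma omit_transpose_swap:
  "omit i (h \<circ> transpose i (i + 1)) = omit (i + 1) h"
  "omit (i + 1) (h \<circ> transpose i (i + 1)) = omit i h"
  by (auto simp: omit_def transpose_def fun_eq_iff intro!: arg_cong[of _ _ h])

text \<open>Up to sign, the swap permutes the summands. Those whose face keeps both swapped entries
  are negated by \<open>alt\<close>; the other two trade faces, and their coefficients are
  opposite.\<close>

lemma homogeneous_coboundary_transpose:
  assumes \<sigma>: "\<sigma> \<in> cochains G A n" and h: "h \<in> {1..n + 2} \<rightarrow> carrier G" and i: "i \<in> {1..n + 1}"
    and alt: "\<And>h i. \<lbrakk>h \<in> {1..n + 1} \<rightarrow> carrier G; i \<in> {1..n}\<rbrakk>
      \<Longrightarrow> homogeneous n \<sigma> (h \<circ> transpose i (i + 1)) = \<ominus>\<^bsub>A\<^esub> homogeneous n \<sigma> h"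
  shows "homogeneous (n + 1) (coboundary G A act n \<sigma>) (h \<circ> transpose i (i + 1))
    = \<ominus>\<^bsub>A\<^esub> homogeneous (n + 1) (coboundary G A act n \<sigma>) h"
proof -
  let ?F = "\<lambda>h j. [((-1) ^ j :: int)] \<cdot>\<^bsub>A\<^esub> homogeneous n \<sigma> (omit (j + 1) h)"
  \<comment> \<open>Summand \<open>j\<close> omits entry \<open>j + 1\<close>, so swapping the
    entries \<open>i\<close> and \<open>i + 1\<close> swaps the summands \<open>i - 1\<close> and
    \<open>i\<close>.\<close>
  let ?t = "transpose i (i + 1)" and ?s = "transpose (i - 1) i"
  have F: "?F h j \<in> carrier A" for j
    using \<sigma> h by (intro A.add.int_pow_closed homogeneous_closed omit_closed)
  have H: "homogeneous n \<sigma> (omit j h) \<in> carrier A" for j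
    using \<sigma> h by (intro homogeneous_closed omit_closed)
  have ht: "h \<circ> ?t \<in> {1..n + 2} \<rightarrow> carrier G"
    using h i by (intro permuted_closed permutes_swap_id) auto
  have s: "?s permutes {0..n + 1}"
    using i by (intro permutes_swap_id) auto
  have "?F (h \<circ> ?t) j = \<ominus>\<^bsub>A\<^esub> ?F h (?s j)" if j: "j \<in> {0..n + 1}" for j
  proof -
    consider "j + 1 < i" | "j + 1 = i" | "j = i" | "i < j" by linarith
    then show ?thesis
    proof cases
      case 1
      then have "homogeneous n \<sigma> (omit (j + 1) (h \<circ> ?t)) = \<ominus>\<^bsub>A\<^esub> homogeneous n \<sigma> (omit (j + 1) h)"
        using i alt[OF omit_closed[OF h], of "i - 1" "j + 1"] omit_transpose_before[of "j + 1" i h]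
        by fastforce
      moreover have "?s j = j"
        using 1 by (intro transpose_apply_other) auto
      ultimately show ?thesis
        using H by (simp add: A.add.int_pow_inv)
    next
      \<comment> \<open>Here the minus sign comes from the coefficients of neighbouring summands,
        not from \<open>alt\<close>.\<close>
      case 2
      then show ?thesis
        using H by (simp add: omit_transpose_swap[of "j + 1", simplified] A.add.int_pow_neg transpose_def flip: 2)
    next
      case 3
      moreover obtain m where "i = Suc m"
        using i by (cases i) auto
      ultimately show ?thesis
        using H by (simp add: omit_transpose_swap[of "Suc m", simplified] A.add.int_pow_neg transpose_def)
    next
      \<comment> \<open>From \<open>i < j <= n + 1\<close> follows \<open>i <= n\<close>, so the
        swap stays within the \<open>n + 1\<close> entries of the face.\<close>
      case 4
      then have "homogeneous n \<sigma> (omit (j + 1) (h \<circ> ?t)) = \<ominus>\<^bsub>A\<^esub> homogeneous n \<sigma> (omit (j + 1) h)"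
        using i j alt[OF omit_closed[OF h], of i "j + 1"] by (auto simp: omit_transpose_after[simplified])
      moreover have "?s j = j"
        using 4 by (intro transpose_apply_other) auto
      ultimately show ?thesis
        using H by (simp add: A.add.int_pow_inv)
    qed
  qed
  then have "(\<Oplus>\<^bsub>A\<^esub>j\<in>{0..n + 1}. ?F (h \<circ> ?t) j) = (\<Oplus>\<^bsub>A\<^esub>j\<in>{0..n + 1}. \<ominus>\<^bsub>A\<^esub> ?F h (?s j))"
    using F by (intro A.finsum_cong') auto
  also have "\<dots> = \<ominus>\<^bsub>A\<^esub> (\<Oplus>\<^bsub>A\<^esub>j\<in>{0..n + 1}. ?F h (?s j))"
    using F by (intro A.finsum_a_inv) auto
  \<comment> \<open>As \<open>?s\<close> permutes the index set, reindexing restores the original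
    sum.\<close>
  also have "(\<Oplus>\<^bsub>A\<^esub>j\<in>{0..n + 1}. ?F h (?s j)) = (\<Oplus>\<^bsub>A\<^esub>j\<in>?s ` {0..n + 1}. ?F h j)"
    using F permutes_inj_on[OF s] by (intro A.finsum_reindex[symmetric]) auto
  also have "?s ` {0..n + 1} = {0..n + 1}"
    using s by (rule permutes_image)
  finally show ?thesis
    unfolding homogeneous_coboundary[OF \<sigma> h] homogeneous_coboundary[OF \<sigma> ht] .
qed

text \<open>Invariance of the cochain makes its homogeneous form change sign under adjacent swaps.
  The coboundary inherits this, the sign in the action cancels it, and adjacent transpositions
  generate.\<close>

lemma coboundary_invariant:
  assumes \<sigma>: "\<sigma> \<in> cochains G A n"
    and inv: "\<And>p. p permutes {1..n + 1} \<Longrightarrow> perm_cochain n p \<sigma> = \<sigma>"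
    and p: "p permutes {1..n + 2}"
  shows "perm_cochain (n + 1) p (coboundary G A act n \<sigma>) = coboundary G A act n \<sigma>"
proof -
  let ?d = "coboundary G A act n \<sigma>"
  have d: "?d \<in> cochains G A (n + 1)"
    using \<sigma> by (rule coboundary_closed)
  have alt: "homogeneous n \<sigma> (h \<circ> transpose i (i + 1)) = \<ominus>\<^bsub>A\<^esub> homogeneous n \<sigma> h"
    if h: "h \<in> {1..n + 1} \<rightarrow> carrier G" and i: "i \<in> {1..n}" for h i
  proof -
    let ?t = "transpose i (i + 1)"
    have t: "?t permutes {1..n + 1}"
      using i by (intro permutes_swap_id) auto
    have c: "homogeneous n \<sigma> (h \<circ> ?t) \<in> carrier A"
      using \<sigma> h t by (intro homogeneous_closed permuted_closed)
    have "homogeneous n \<sigma> h = \<ominus>\<^bsub>A\<^esub> homogeneous n \<sigma> (h \<circ> ?t)"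
      using homogeneous_perm_cochain[OF \<sigma> t h] c unfolding inv[OF t] by (simp add: sign_swap_id A.add.int_pow_neg)
    then show ?thesis
      using c by simp
  qed
  from p have "p permutes {1..n + 1 + 1}"
    by simp
  then show ?thesis
  proof (rule adjacent_transpositions_generate)
    show "perm_cochain (n + 1) id ?d = ?d"
      using d by (rule perm_cochain_id)
  next
    fix q r
    assume "q permutes {1..n + 1 + 1}" "r permutes {1..n + 1 + 1}"
      and "perm_cochain (n + 1) q ?d = ?d" "perm_cochain (n + 1) r ?d = ?d"
    then show "perm_cochain (n + 1) (q \<circ> r) ?d = ?d"
      using d by (simp add: perm_cochain_compose)
  next
    fix i assume i: "i \<in> {1..n + 1}"
    let ?t = "transpose i (i + 1)"
    have t: "?t permutes {1..n + 1 + 1}"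
      using i by (intro permutes_swap_id) auto
    have "[sign ?t] \<cdot>\<^bsub>A\<^esub> homogeneous (n + 1) ?d (partial_products g \<circ> ?t) = homogeneous (n + 1) ?d (partial_products g)"
      if g: "g \<in> tuples G (n + 1)" for g
    proof -
      have h: "partial_products g \<in> {1..n + 1 + 1} \<rightarrow> carrier G"
        using g by (rule partial_products_closed)
      then have "homogeneous (n + 1) ?d (partial_products g \<circ> ?t) = \<ominus>\<^bsub>A\<^esub> homogeneous (n + 1) ?d (partial_products g)"
        using \<sigma> i alt by (intro homogeneous_coboundary_transpose) auto
      then show ?thesis
        using homogeneous_closed[OF d h] by (simp add: sign_swap_id A.add.int_pow_neg)
    qed
    \<comment> \<open>Writing the coboundary as its own image under \<open>id\<close> puts both
      sides in homogeneous form.\<close>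
    then have "perm_cochain (n + 1) ?t ?d = perm_cochain (n + 1) id ?d"
      using d homogeneous_closed[OF d partial_products_closed]
      by (simp add: perm_cochain_def cong: restrict_cong)
    also have "\<dots> = ?d"
      using d by (rule perm_cochain_id)
    finally show "perm_cochain (n + 1) ?t ?d = ?d" .
  qed
qed

end

theorem proposition5p1:
  fixes G :: "('g, 'm) monoid_scheme" and A :: "('a, 'r) ring_scheme" and act :: "'g \<Rightarrow> 'a \<Rightarrow> 'a"
  assumes "gmodule G A act"
  shows "\<exists>\<phi>.
    (\<forall>n. is_cochain_action G A act n (\<phi> n) \<and>
         (\<forall>\<psi>. is_cochain_action G A act n \<psi> \<longrightarrow>
              (\<forall>p \<in> carrier (sym_group (n + 1)). \<psi> p = \<phi> n p))) \<and>
    (\<forall>n. \<forall>\<sigma> \<in> cochains G A n.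
         (\<forall>p \<in> carrier (sym_group (n + 1)). \<phi> n p \<sigma> = \<sigma>) \<longrightarrow>
         coboundary G A act n \<sigma> \<in> cochains G A (n + 1) \<and>
         (\<forall>p \<in> carrier (sym_group (n + 2)).
            \<phi> (n + 1) p (coboundary G A act n \<sigma>) = coboundary G A act n \<sigma>))"
proof -
  interpret gmodule G A act
    by fact
  show ?thesis
  \<comment> \<open>\<open>perm_cochain\<close> takes the degree as its first argument, so it
    supplies the actions for all \<open>n\<close> at once.\<close>
  proof (rule exI[of _ perm_cochain], intro conjI allI impI ballI)
    fix n
    show "is_cochain_action G A act n (perm_cochain n)"
      by (rule is_cochain_action_perm_cochain)
  next
    fix n \<psi> p
    assume "is_cochain_action G A act n \<psi>" "p \<in> carrier (sym_group (n + 1))"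
    then show "\<psi> p = perm_cochain n p"
      by (rule cochain_action_unique[OF _ is_cochain_action_perm_cochain])
  next
    fix n \<sigma>
    assume "\<sigma> \<in> cochains G A n"
    then show "coboundary G A act n \<sigma> \<in> cochains G A (n + 1)"
      by (rule coboundary_closed)
  next
    fix n \<sigma> p
    assume "\<sigma> \<in> cochains G A n" "\<forall>p \<in> carrier (sym_group (n + 1)). perm_cochain n p \<sigma> = \<sigma>"
      and "p \<in> carrier (sym_group (n + 2))"
    then show "perm_cochain (n + 1) p (coboundary G A act n \<sigma>) = coboundary G A act n \<sigma>"
      by (intro coboundary_invariant) (simp_all add: sym_group_carrier)
  qed
qed

end
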